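(* Let $\tau$ be a topology on $X$. Let $\beta> 0$, $y\in Y$, and let $F\colon X\to Y$ be a mapping; let $(\beta_k)_{k\in\mathbb N}$ be a sequence of nonnegative numbers, $(y_k)_{k\in\mathbb N}$ a sequence in $Y$, and $(F_k)_{k\in\mathbb N}$ a sequence of mappings $F_k\colon X\to Y$. Assume that $\beta_k\to\beta$, that $(y_k)$ converges $\mathcal S$-uniformly to $y$, and that $(F_k)$ converges locally $\mathcal S$-uniformly to $F$. Assume that the sets $\Phi_{\mathcal R}(F_k,w,\gamma,t)$ and $\Phi_{\mathcal R}(F,w,\gamma,t)$ are $\tau$-compact for all $w\in Y$, $\gamma\ge 0$, $t\ge 0$ and $k\in\mathbb N$, and that for every $w\in Y$, $\gamma\ge 0$, $k\in\mathbb N$ there exists some $t_0$ such that $\Phi_{\mathcal R}(F_k,w,\gamma,t_0)$ and $\Phi_{\mathcal R}(F,w,\gamma,t_0)$ are non-empty. Assume moreover that the inclusion \[ \Phi_{\mathcal R}(F,y,\beta,t)\subset\bigcap_{\delta>0}\operatorname{cl}_\tau\Bigl(\bigcup_{\varepsilon>0}\Phi_{\mathcal R}(F,y,\beta-\varepsilon,t+\delta)\Bigr) \] holds for every $t\ge0$, where $\operatorname{cl}_\tau$ denotes the closure with respect to $\tau$. Then \[ \emptyset\neq \tau_{\mathcal R}\text{-}\limsup_{k\to\infty}\Sigma(F_k,y_k,\beta_k)\subset \Sigma(F,y,\beta). \] If, additionally, the set $\Sigma(F,y,\beta)$ consists of a single element $x_\beta$, then \[ \{x_\beta\}=\tau_{\mathcal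 R}\text{-}\lim_{k\to\infty}\Sigma(F_k,y_k,\beta_k). \]
   Context: $X$ and $Y$ are sets, $\mathcal R\colon X\to[0,+\infty]$ is a functional, and $\mathcal S\colon Y\times Y\to[0,+\infty]$ is a functional with $\mathcal S(y,z)=0$ if and only if $y=z$. For a mapping $G\colon X\to Y$, $w\in Y$ and real $\gamma$, $t$ (with $\inf\emptyset=+\infty$; sets with $\gamma<0$ are empty): \[ \Phi(G,w,\gamma):=\{x\in X:\mathcal S(G(x),w)\le\gamma\},\quad v(G,w,\gamma):=\inf\{\mathcal R(x):x\in\Phi(G,w,\gamma)\}, \] \[ \Sigma(G,w,\gamma):=\{x\in\Phi(G,w,\gamma):\mathcal R(x)=v(G,w,\gamma)\},\quad \Phi_{\mathcal R}(G,w,\gamma,t):=\Phi(G,w,\gamma)\cap\{x\in X:\mathcal R(x)\le t\}. \] $(y_k)$ converges $\mathcal S$-uniformly to $y$ if $\sup\{|\mathcal S(z,y_k)-\mathcal S(z,y)|:z\in Y\}\to0$. $(F_k)$ converges locally $\mathcal S$-uniformly to $F$ if for every $t\ge0$, $\sup\{|\mathcal S(F_k(x),z)-\mathcal S(F(x),z)|:z\in Y,\ x\in X,\ \mathcal R(x)\le t\}\to0$. The topology $\tau_{\mathcal R}$ on $X$ is the one generated by all sets $U\cap\{x\in X:\mathcal R(x)>s\}$ with $U\in\tau$, $s\in\mathbb R$, and all sets $U\cap\{x\in X:\mathcal R(x)<t\}$ with $U\in\tau$, $t\in\mathbb R\cup\{\infty\}$. For a topology $\sigma$ on $X$ and a sequence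 $(\Sigma_k)$ of subsets of $X$: the upper limit is $\sigma\text{-}\limsup_{k}\Sigma_k:=\bigcap_{k\in\mathbb N}\operatorname{cl}_\sigma\bigl(\bigcup_{k'\ge k}\Sigma_{k'}\bigr)$; the lower limit $\sigma\text{-}\liminf_k\Sigma_k$ is the set of all $x\in X$ such that for every $\sigma$-neighborhood $N$ of $x$ there is $k_0$ with $N\cap\Sigma_k\ne\emptyset$ for all $k\ge k_0$; if the two coincide, their common value is the limit $\sigma\text{-}\lim_k\Sigma_k$ (an equation involving this limit includes the assertion that it exists).
   Formalization: The sets Φ_R(F_k,w,γ,t) and Φ_R(F,w,γ,t) are assumed τ-closed as well as τ-compact (automatic if τ is Hausdorff); without this the claim fails, e.g. for the cofinite topology on ℕ with R(n)=1/(n+1), S=0 and Y a point. *)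

theory Defs
  imports "HOL-Analysis.Analysis"
begin

text \<open>
  The sets \<open>X\<close> and \<open>Y\<close> are the types \<open>'x\<close> and \<open>'y\<close>. Functionals with values in
  \<open>[0,\<infinity>]\<close> have type \<open>ennreal\<close>. They are compared with real thresholds in \<open>ereal\<close>, because
  \<open>ennreal \<gamma> = 0\<close> for \<open>\<gamma> < 0\<close>, whereas sublevel sets for negative thresholds have to be empty.
\<close>

definition feasible :: "('y \<Rightarrow> 'y \<Rightarrow> ennreal) \<Rightarrow> ('x \<Rightarrow> 'y) \<Rightarrow> 'y \<Rightarrow> real \<Rightarrow> 'x set"
  where "feasible S G w \<gamma> = {x. enn2ereal (S (G x) w) \<le> ereal \<gamma>}"

definition opt_val ::
    "('x \<Rightarrow> ennreal) \<Rightarrow> ('y \<Rightarrow> 'y \<Rightarrow> ennreal) \<Rightarrow> ('x \<Rightarrow> 'y) \<Rightarrow> 'y \<Rightarrow> real \<Rightarrow> ennreal"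
  where "opt_val R S G w \<gamma> = (INF x\<in>feasible S G w \<gamma>. R x)"

definition solutions ::
    "('x \<Rightarrow> ennreal) \<Rightarrow> ('y \<Rightarrow> 'y \<Rightarrow> ennreal) \<Rightarrow> ('x \<Rightarrow> 'y) \<Rightarrow> 'y \<Rightarrow> real \<Rightarrow> 'x set"
  where "solutions R S G w \<gamma> = {x \<in> feasible S G w \<gamma>. R x = opt_val R S G w \<gamma>}"

definition feasible_lev ::
    "('x \<Rightarrow> ennreal) \<Rightarrow> ('y \<Rightarrow> 'y \<Rightarrow> ennreal) \<Rightarrow> ('x \<Rightarrow> 'y) \<Rightarrow> 'y \<Rightarrow> real \<Rightarrow> real \<Rightarrow> 'x set"
  where "feasible_lev R S G w \<gamma> t = feasible S G w \<gamma> \<inter> {x. enn2ereal (R x) \<le> ereal t}"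

text \<open>
  The absolute difference \<open>\<bar>a - b\<bar>\<close> in \<open>[0,\<infinity>]\<close>, with the convention \<open>\<bar>\<infinity> - \<infinity>\<bar> = 0\<close>. Subtraction on
  \<open>ennreal\<close> is truncated at \<open>0\<close>, and \<open>\<infinity> - \<infinity> = \<infinity>\<close> there, hence the case distinction.
\<close>

definition absdiff :: "ennreal \<Rightarrow> ennreal \<Rightarrow> ennreal"
  where "absdiff a b = (if a = b then 0 else max (a - b) (b - a))"

definition S_uniform_conv :: "('y \<Rightarrow> 'y \<Rightarrow> ennreal) \<Rightarrow> (nat \<Rightarrow> 'y) \<Rightarrow> 'y \<Rightarrow> bool"
  where "S_uniform_conv S ys y \<longleftrightarrow> (\<lambda>k. SUP z. absdiff (S z (ys k)) (S z y)) \<longlonglongrightarrow> 0"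

text \<open>The supremum over an empty set is \<open>0\<close>, as suprema are taken in \<open>ennreal\<close>.\<close>

definition locally_S_uniform_conv ::
    "('x \<Rightarrow> ennreal) \<Rightarrow> ('y \<Rightarrow> 'y \<Rightarrow> ennreal) \<Rightarrow> (nat \<Rightarrow> 'x \<Rightarrow> 'y) \<Rightarrow> ('x \<Rightarrow> 'y) \<Rightarrow> bool"
  where "locally_S_uniform_conv R S Fs F \<longleftrightarrow>
    (\<forall>t::real. t \<ge> 0 \<longrightarrow>
      (\<lambda>k. SUP (z, x) \<in> UNIV \<times> {x. enn2ereal (R x) \<le> ereal t}.
              absdiff (S (Fs k x) z) (S (F x) z)) \<longlonglongrightarrow> 0)"

text \<open>
  The bound \<open>s\<close> ranges over the reals, \<open>t\<close> over the reals and \<open>\<infinity>\<close>.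
\<close>

definition topology_R :: "'x topology \<Rightarrow> ('x \<Rightarrow> ennreal) \<Rightarrow> 'x topology"
  where "topology_R \<tau> R = topology_generated_by
    ({U \<inter> {x. enn2ereal (R x) > ereal s} |U s. openin \<tau> U} \<union>
     {U \<inter> {x. enn2ereal (R x) < t} |U (t::ereal). openin \<tau> U \<and> t \<noteq> -\<infinity>})"

definition upper_limit :: "'x topology \<Rightarrow> (nat \<Rightarrow> 'x set) \<Rightarrow> 'x set"
  where "upper_limit \<sigma> A = (\<Inter>k. \<sigma> closure_of (\<Union>k'\<in>{k..}. A k'))"

definition neighbourhood :: "'x topology \<Rightarrow> 'x \<Rightarrow> 'x set \<Rightarrow> bool"
  where "neighbourhood \<sigma> x N \<longleftrightarrow> N \<subseteq> topspace \<sigma> \<and> (\<exists>U. openin \<sigma> U \<and> x \<in> U \<and> U \<subseteq> N)"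

definition lower_limit :: "'x topology \<Rightarrow> (nat \<Rightarrow> 'x set) \<Rightarrow> 'x set"
  where "lower_limit \<sigma> A =
    {x \<in> topspace \<sigma>. \<forall>N. neighbourhood \<sigma> x N \<longrightarrow> (\<exists>k0. \<forall>k\<ge>k0. N \<inter> A k \<noteq> {})}"

definition has_set_limit :: "'x topology \<Rightarrow> (nat \<Rightarrow> 'x set) \<Rightarrow> 'x set \<Rightarrow> bool"
  where "has_set_limit \<sigma> A L \<longleftrightarrow> upper_limit \<sigma> A = L \<and> lower_limit \<sigma> A = L"

end

theory Submission
  imports Defs
begin

text \<open>
  By the inclusion hypothesis, almost-minimisers for \<open>(F, y, \<beta>)\<close> can be chosen with discrepancy
  strictly below \<open>\<beta>\<close>, so they stay feasible for the perturbed problems, and the perturbed optimal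
  values are asymptotically at most the optimal value \<open>v\<close>. Hence the perturbed solution sets are
  eventually contained in each of the closed compact sets \<open>\<Phi>\<^sub>R(F, y, \<beta> + \<epsilon>, v + \<epsilon>)\<close>, which shrink to
  \<open>\<Sigma>(F, y, \<beta>)\<close>. Compactness then shows that closed sets met infinitely often by the perturbed
  solution sets meet \<open>\<Sigma>(F, y, \<beta>)\<close>; applied to sublevel sets this gives convergence of the optimal
  values, which makes \<open>\<tau>\<close>-limits and \<open>\<tau>\<^sub>R\<close>-limits agree.
\<close>

section \<open>Extended nonnegative values and thresholds\<close>

text \<open>Each truncated difference is at most their maximum; the additive form stays usable for
  infinite values.\<close>

lemma le_add_of_absdiff_le:
  assumes "absdiff a b \<le> c"
  shows "a \<le> b + c" and "b \<le> a + c"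
  using assms unfolding absdiff_def
  by (auto split: if_splits simp: ennreal_minus_le_iff)

lemma enn2ereal_le_ereal_iff:
  assumes "\<gamma> \<ge> 0"
  shows "enn2ereal a \<le> ereal \<gamma> \<longleftrightarrow> a \<le> ennreal \<gamma>"
  using assms by (simp add: less_eq_ennreal.rep_eq enn2ereal_ennreal)

lemma mem_feasible:
  assumes "\<gamma> \<ge> 0"
  shows "x \<in> feasible S G w \<gamma> \<longleftrightarrow> S (G x) w \<le> ennreal \<gamma>"
  using assms by (simp add: feasible_def enn2ereal_le_ereal_iff)

lemma mem_feasible_lev:
  assumes "\<gamma> \<ge> 0" "t \<ge> 0"
  shows "x \<in> feasible_lev R S G w \<gamma> t \<longleftrightarrow> S (G x) w \<le> ennreal \<gamma> \<and> R x \<le> ennreal t"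
  using assms by (simp add: feasible_lev_def mem_feasible enn2ereal_le_ereal_iff)

text \<open>All values are at least \<open>0\<close>, so a single point forces nonnegative
  thresholds. Later this bounds the slack \<open>\<epsilon>\<close> by
  \<open>\<beta>\<close>.\<close>

lemma feasible_lev_nonneg:
  assumes "x \<in> feasible_lev R S G w \<gamma> t"
  shows "\<gamma> \<ge> 0" "t \<ge> 0"
proof -
  have "enn2ereal (S (G x) w) \<le> ereal \<gamma>" "enn2ereal (R x) \<le> ereal t"
    using assms unfolding feasible_lev_def feasible_def by auto
  then have "0 \<le> ereal \<gamma>" "0 \<le> ereal t"
    using enn2ereal_nonneg order_trans by blast+
  then show "\<gamma> \<ge> 0" "t \<ge> 0" by auto
qed

lemma opt_val_le:
  assumes "x \<in> feasible S G w \<gamma>"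
  shows "opt_val R S G w \<gamma> \<le> R x"
  unfolding opt_val_def using assms by (rule INF_lower)

section \<open>Nested compact sets\<close>

text \<open>Cantor's intersection theorem inside the compact subspace \<open>C 0\<close>. Closedness
  is a separate assumption, as compact sets need not be closed in a space that is not
  Hausdorff.\<close>

lemma compactin_nest:
  assumes comp: "\<And>n. compactin X (C n)" and closed: "\<And>n. closedin X (C n)"
    and nonempty: "\<And>n. C n \<noteq> {}" and dec: "decseq C"
  shows "(\<Inter>n::nat. C n) \<noteq> {}"
proof -
  have sub: "C n \<subseteq> C 0" for n
    using dec by (simp add: decseq_def)
  have "compact_space (subtopology X (C 0))"
    using comp by (simp add: compact_space_subtopology)
  moreover have "closedin (subtopology X (C 0)) (C n)" for n
    using closed sub by (simp add: closedin_subset_topspace closedin_subtopology_Int_closed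
        inf.absorb_iff2 closedin_closed_subtopology)
  ultimately show ?thesis
    using nonempty dec by (intro compact_space_imp_nest)
qed

text \<open>For each \<open>n\<close> some \<open>A k\<close> lies in \<open>K n\<close> and meets
  \<open>D n\<close>, so the sets \<open>K n \<inter> D n\<close> are non-empty, compact, closed and
  decreasing.\<close>

lemma nested_compact_meets_closed:
  assumes comp: "\<And>n. compactin X (K n)" and closed: "\<And>n. closedin X (K n)" and dec: "decseq K"
    and ev: "\<And>n. \<forall>\<^sub>F k in sequentially. A k \<subseteq> K n"
    and closedD: "\<And>n. closedin X (D n)" and decD: "decseq D"
    and freq: "\<And>n. \<exists>\<^sub>F k in sequentially. A k \<inter> D n \<noteq> {}"
  shows "(\<Inter>n::nat. K n) \<inter> (\<Inter>n. D n) \<noteq> {}"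
proof -
  have "(\<Inter>n. K n \<inter> D n) \<noteq> {}"
  proof (rule compactin_nest)
    show "compactin X (K n \<inter> D n)" for n
      using comp closedD by (simp add: compact_Int_closedin)
    show "closedin X (K n \<inter> D n)" for n
      using closed closedD by blast
    show "decseq (\<lambda>n. K n \<inter> D n)"
      using dec decD unfolding decseq_def by blast
    show "K n \<inter> D n \<noteq> {}" for n
    proof -
      have "\<exists>\<^sub>F k in sequentially. A k \<inter> D n \<noteq> {} \<and> A k \<subseteq> K n"
        using frequently_eventually_frequently[OF freq ev] .
      then show ?thesis
        by (blast dest: frequently_ex)
    qed
  qed
  then show ?thesis by blast
qed

section \<open>Shrinking sublevel sets\<close>

text \<open>The thresholds decrease to \<open>\<gamma>\<close> and \<open>r\<close>, and non-strict
  inequalities survive the limit. The factor \<open>a\<close> covers two uses: \<open>a = 0\<close>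
  relaxes only the bound on \<open>R\<close>, \<open>a = 1\<close> relaxes both.\<close>

lemma Inter_feasible_lev:
  assumes "a \<ge> 0"
  shows "(\<Inter>n. feasible_lev R S G w (\<gamma> + a / real (Suc n)) (r + 1 / real (Suc n)))
      = feasible_lev R S G w \<gamma> r"
proof -
  have lim: "(\<lambda>n. ereal (c + b / real (Suc n))) \<longlonglongrightarrow> ereal c" for b c
  proof -
    have "(\<lambda>n. c + b * inverse (real (Suc n))) \<longlonglongrightarrow> c + b * 0"
      by (intro tendsto_intros LIMSEQ_inverse_real_of_nat)
    then show ?thesis by (simp add: divide_inverse)
  qed
  have iff: "(\<forall>n. u \<le> ereal (c + b / real (Suc n))) \<longleftrightarrow> u \<le> ereal c" if "b \<ge> 0" for u b c
  proof
    assume "\<forall>n. u \<le> ereal (c + b / real (Suc n))"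
    then show "u \<le> ereal c"
      by (intro LIMSEQ_le_const[OF lim]) blast
  next
    assume "u \<le> ereal c"
    moreover have "ereal c \<le> ereal (c + b / real (Suc n))" for n
      using that by simp
    ultimately show "\<forall>n. u \<le> ereal (c + b / real (Suc n))"
      by (meson order_trans)
  qed
  show ?thesis
    unfolding feasible_lev_def feasible_def set_eq_iff
    using iff[OF assms] iff[of 1] by (simp add: all_conj_distrib)
qed

lemma feasible_lev_mono:
  assumes "\<gamma> \<le> \<gamma>'" "t \<le> t'"
  shows "feasible_lev R S G w \<gamma> t \<subseteq> feasible_lev R S G w \<gamma>' t'"
proof -
  have "ereal \<gamma> \<le> ereal \<gamma>'" "ereal t \<le> ereal t'" using assms by simp_all
  then show ?thesis
    unfolding feasible_lev_def feasible_def by (auto intro: order_trans)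
qed

lemma decseq_feasible_lev:
  assumes "a \<ge> 0"
  shows "decseq (\<lambda>n. feasible_lev R S G w (\<gamma> + a / real (Suc n)) (r + 1 / real (Suc n)))"
  unfolding decseq_def using assms
  by (intro allI impI feasible_lev_mono add_left_mono divide_left_mono) auto

section \<open>Existence of minimisers\<close>

text \<open>Feasible points never go below the infimum, so for them \<open>R x \<le> r\<close>
  already means equality.\<close>

lemma solutions_eq_feasible_lev:
  assumes "opt_val R S G w \<gamma> = ennreal r" "\<gamma> \<ge> 0" "r \<ge> 0"
  shows "solutions R S G w \<gamma> = feasible_lev R S G w \<gamma> r"
  using assms opt_val_le[of _ S G w \<gamma> R]
  by (auto simp: solutions_def mem_feasible_lev mem_feasible intro: antisym)

text \<open>The direct method: feasible points with \<open>R x \<le> r + 1/(n+1)\<close> form nested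
  non-empty compact sets, and their common points are minimisers.\<close>

lemma opt_val_attained:
  assumes "\<gamma> \<ge> 0"
    and comp: "\<And>t. t \<ge> 0 \<Longrightarrow> compactin \<tau> (feasible_lev R S G w \<gamma> t)"
    and closed: "\<And>t. t \<ge> 0 \<Longrightarrow> closedin \<tau> (feasible_lev R S G w \<gamma> t)"
    and "feasible_lev R S G w \<gamma> t0 \<noteq> {}"
  obtains r where "r \<ge> 0" "opt_val R S G w \<gamma> = ennreal r" "solutions R S G w \<gamma> \<noteq> {}"
proof -
  obtain x0 where x0: "x0 \<in> feasible_lev R S G w \<gamma> t0" using assms by blast
  have "opt_val R S G w \<gamma> \<le> R x0"
    using x0 by (intro opt_val_le) (simp add: feasible_lev_def)
  also have "\<dots> \<le> ennreal t0"
    using x0 feasible_lev_nonneg[OF x0] by (simp add: mem_feasible_lev)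
  finally obtain r where r: "r \<ge> 0" "opt_val R S G w \<gamma> = ennreal r"
    by (metis ennreal_cases ennreal_neq_top top.extremum_uniqueI)
  \<comment> \<open>The summand \<open>0 / real (Suc n)\<close> only brings the set into the shape
    of \<open>Inter_feasible_lev\<close>.\<close>
  let ?C = "\<lambda>n. feasible_lev R S G w (\<gamma> + 0 / real (Suc n)) (r + 1 / real (Suc n))"
  have "(\<Inter>n. ?C n) \<noteq> {}"
  proof (rule compactin_nest[of \<tau>])
    show "compactin \<tau> (?C n)" "closedin \<tau> (?C n)" for n
      using comp closed r(1) by simp_all
    show "decseq ?C" by (rule decseq_feasible_lev) simp
    show "?C n \<noteq> {}" for n
    proof -
      have "opt_val R S G w \<gamma> < ennreal (r + 1 / real (Suc n))"
        using r by (simp add: ennreal_less_iff)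
      then obtain x where "x \<in> feasible S G w \<gamma>" "R x < ennreal (r + 1 / real (Suc n))"
        unfolding opt_val_def INF_less_iff by blast
      then have "x \<in> ?C n"
        using r(1) \<open>\<gamma> \<ge> 0\<close> by (simp add: mem_feasible_lev mem_feasible)
      then show ?thesis by blast
    qed
  qed
  moreover have "(\<Inter>n. ?C n) = feasible_lev R S G w \<gamma> r"
    by (rule Inter_feasible_lev) simp
  ultimately have "solutions R S G w \<gamma> \<noteq> {}"
    using solutions_eq_feasible_lev[OF r(2) \<open>\<gamma> \<ge> 0\<close> r(1)]
    by simp
  with r that show ?thesis by blast
qed

section \<open>Perturbation of the discrepancy\<close>

text \<open>Pass through \<open>S (Fs k x) y\<close>: replacing \<open>ys k\<close> by
  \<open>y\<close> costs \<open>e / 2\<close>, uniformly in the first argument; replacing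
  \<open>Fs k\<close> by \<open>F\<close> costs another \<open>e / 2\<close>, on a sublevel set of
  \<open>R\<close> since that convergence is local.\<close>

lemma eventually_discrepancy_close:
  assumes "S_uniform_conv S ys y" "locally_S_uniform_conv R S Fs F" "t \<ge> 0" "e > 0"
  shows "\<forall>\<^sub>F k in sequentially. \<forall>x. R x \<le> ennreal t \<longrightarrow>
    S (Fs k x) (ys k) \<le> S (F x) y + ennreal e \<and> S (F x) y \<le> S (Fs k x) (ys k) + ennreal e"
proof -
  have e: "0 < ennreal (e / 2)" using assms by simp
  have "\<forall>\<^sub>F k in sequentially. (SUP z. absdiff (S z (ys k)) (S z y)) < ennreal (e / 2)"
    using assms(1) e unfolding S_uniform_conv_def by (rule order_tendstoD)
  moreover have "\<forall>\<^sub>F k in sequentially. (SUP (z, x) \<in> UNIV \<times> {x. enn2ereal (R x) \<le> ereal t}.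
              absdiff (S (Fs k x) z) (S (F x) z)) < ennreal (e / 2)"
    by (rule order_tendstoD(2)[OF assms(2)[unfolded locally_S_uniform_conv_def, rule_format, OF assms(3)] e])
  ultimately show ?thesis
  proof eventually_elim
    case (elim k)
    show ?case
    proof (intro allI impI)
      fix x assume "R x \<le> ennreal t"
      then have x: "enn2ereal (R x) \<le> ereal t"
        using \<open>t \<ge> 0\<close> by (simp add: enn2ereal_le_ereal_iff)
      have "absdiff (S (Fs k x) (ys k)) (S (Fs k x) y) \<le> ennreal (e / 2)"
        by (rule order_trans[OF SUP_upper less_imp_le[OF elim(1)]]) simp
      note 1 = le_add_of_absdiff_le[OF this]
      have "absdiff (S (Fs k x) y) (S (F x) y)
          \<le> (SUP (z, x) \<in> UNIV \<times> {x. enn2ereal (R x) \<le> ereal t}. absdiff (S (Fs k x) z) (S (F x) z))"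
        using x by (intro SUP_upper2[of "(y, x)"]) auto
      also have "\<dots> \<le> ennreal (e / 2)" using elim(2) by simp
      finally have "absdiff (S (Fs k x) y) (S (F x) y) \<le> ennreal (e / 2)" .
      note 2 = le_add_of_absdiff_le[OF this]
      have e2: "ennreal (e / 2) + ennreal (e / 2) = ennreal e"
        using \<open>e > 0\<close> by (simp flip: ennreal_plus)
      have "S (Fs k x) (ys k) \<le> (S (F x) y + ennreal (e / 2)) + ennreal (e / 2)"
        using 1(1) 2(1) by (meson add_right_mono order_trans)
      moreover have "S (F x) y \<le> (S (Fs k x) (ys k) + ennreal (e / 2)) + ennreal (e / 2)"
        using 1(2) 2(2) by (meson add_right_mono order_trans)
      ultimately show "S (Fs k x) (ys k) \<le> S (F x) y + ennreal e
          \<and> S (F x) y \<le> S (Fs k x) (ys k) + ennreal e"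
        by (simp add: add.assoc e2)
    qed
  qed
qed

section \<open>The topology refined by the values of \<open>R\<close>\<close>

lemma openin_topology_R:
  assumes "openin \<tau> U"
  shows "openin (topology_R \<tau> R) U"
proof -
  \<comment> \<open>\<open>R\<close> is nonnegative, so the bound \<open>-1\<close> excludes nothing
    and \<open>U\<close> is itself a generator.\<close>
  have "U = U \<inter> {x. enn2ereal (R x) > ereal (-1)}"
    by (auto intro: less_le_trans[OF _ enn2ereal_nonneg])
  then show ?thesis
    unfolding topology_R_def openin_topology_generated_by_iff using assms
    by (intro generate_topology_on.Basis UnI1 CollectI exI[of _ U] exI[of _ "-1"]) auto
qed

lemma topspace_topology_R [simp]: "topspace (topology_R \<tau> R) = topspace \<tau>"
proof
  show "topspace (topology_R \<tau> R) \<subseteq> topspace \<tau>"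
    unfolding topology_R_def topology_generated_by_topspace
    by (auto dest: openin_subset)
  show "topspace \<tau> \<subseteq> topspace (topology_R \<tau> R)"
    by (intro openin_subset openin_topology_R openin_topspace)
qed

text \<open>Sets combining a \<open>\<tau>\<close>-open \<open>U\<close> with the
  \<open>R\<close>-preimage of an open \<open>V\<close> are stable under intersection, and the
  generators are of this kind because \<open>enn2ereal\<close> is continuous.\<close>

lemma topology_R_neighbourhood:
  assumes "openin (topology_R \<tau> R) W" "x \<in> W"
  obtains U V where "openin \<tau> U" "x \<in> U" "open V" "R x \<in> V" "U \<inter> R -` V \<subseteq> W"
proof -
  have cont: "continuous_on UNIV enn2ereal"
    by (rule continuous_on_enn2ereal)
  have "\<forall>x\<in>W. \<exists>U V. openin \<tau> U \<and> x \<in> U \<and> open V \<and> R x \<in> V \<and> U \<inter> R -` V \<subseteq> W"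
    using assms(1) unfolding topology_R_def openin_topology_generated_by_iff
  proof induction
    case Empty
    then show ?case by simp
  next
    case (Int a b)
    show ?case
    proof
      fix x assume "x \<in> a \<inter> b"
      with Int obtain U V U' V' where
        "openin \<tau> U" "x \<in> U" "open V" "R x \<in> V" "U \<inter> R -` V \<subseteq> a"
        "openin \<tau> U'" "x \<in> U'" "open V'" "R x \<in> V'" "U' \<inter> R -` V' \<subseteq> b"
        by (meson IntD1 IntD2)
      then show "\<exists>U V. openin \<tau> U \<and> x \<in> U \<and> open V \<and> R x \<in> V \<and> U \<inter> R -` V \<subseteq> a \<inter> b"
        by (intro exI[of _ "U \<inter> U'"] exI[of _ "V \<inter> V'"]) auto
    qed
  next
    case (UN \<K>)
    then show ?case by (meson Sup_upper UnionE order_trans)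
  next
    case (Basis B)
    then consider U s where "openin \<tau> U" "B = U \<inter> {x. enn2ereal (R x) > ereal s}"
      | U t where "openin \<tau> U" "B = U \<inter> {x. enn2ereal (R x) < t}"
      by blast
    then show ?case
    proof cases
      case 1
      moreover have "open (enn2ereal -` {ereal s<..})"
        using cont by (simp add: open_vimage)
      ultimately show ?thesis
        by (intro ballI exI[of _ U] exI[of _ "enn2ereal -` {ereal s<..}"]) auto
    next
      case 2
      moreover have "open (enn2ereal -` {..<t})"
        using cont by (simp add: open_vimage)
      ultimately show ?thesis
        by (intro ballI exI[of _ U] exI[of _ "enn2ereal -` {..<t}"]) auto
    qed
  qed
  with assms(2) that show ?thesis by blast
qed

section \<open>Upper and lower limits of sets\<close>

lemma mem_upper_limit:
  "x \<in> upper_limit \<sigma> A \<longleftrightarrow> x \<in> topspace \<sigma> \<and>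
    (\<forall>U. openin \<sigma> U \<and> x \<in> U \<longrightarrow> (\<exists>\<^sub>F k in sequentially. U \<inter> A k \<noteq> {}))"
  unfolding upper_limit_def in_closure_of frequently_sequentially INT_iff
  by (auto simp: in_closure_of) blast+

lemma mem_lower_limit:
  "x \<in> lower_limit \<sigma> A \<longleftrightarrow> x \<in> topspace \<sigma> \<and>
    (\<forall>U. openin \<sigma> U \<and> x \<in> U \<longrightarrow> (\<forall>\<^sub>F k in sequentially. U \<inter> A k \<noteq> {}))"
proof -
  have "(\<forall>N. neighbourhood \<sigma> x N \<longrightarrow> (\<exists>k0. \<forall>k\<ge>k0. N \<inter> A k \<noteq> {})) \<longleftrightarrow>
      (\<forall>U. openin \<sigma> U \<and> x \<in> U \<longrightarrow> (\<exists>k0. \<forall>k\<ge>k0. U \<inter> A k \<noteq> {}))" (is "?L \<longleftrightarrow> ?R")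
  proof
    assume ?L
    then show ?R
      unfolding neighbourhood_def by (meson openin_subset order_refl)
  next
    assume R: ?R
    show ?L
    proof (intro allI impI)
      fix N assume "neighbourhood \<sigma> x N"
      then obtain U where U: "openin \<sigma> U" "x \<in> U" "U \<subseteq> N"
        unfolding neighbourhood_def by blast
      with R obtain k0 where "\<forall>k\<ge>k0. U \<inter> A k \<noteq> {}" by blast
      with U(3) show "\<exists>k0. \<forall>k\<ge>k0. N \<inter> A k \<noteq> {}" by blast
    qed
  qed
  then show ?thesis
    by (simp add: lower_limit_def eventually_sequentially)
qed

lemma lower_limit_subset_upper_limit: "lower_limit \<sigma> A \<subseteq> upper_limit \<sigma> A"
  by (auto simp: mem_upper_limit mem_lower_limit intro!: eventually_frequently)

lemma upper_limit_topology_R_subset: "upper_limit (topology_R \<tau> R) A \<subseteq> upper_limit \<tau> A"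
  by (auto simp: mem_upper_limit openin_topology_R)

text \<open>\<open>R\<close> is constant on each \<open>A k\<close>, so convergence of these
  constants moves whole sets \<open>A k\<close> at once.\<close>

lemma eventually_level_near:
  assumes "\<And>k z. z \<in> A k \<Longrightarrow> R z = v k" "v \<longlonglongrightarrow> R x" "open V" "R x \<in> V"
  shows "\<forall>\<^sub>F k in sequentially. A k \<subseteq> R -` V"
  using topological_tendstoD[OF assms(2-4)] by eventually_elim (use assms(1) in auto)

text \<open>Convergence of the values settles the \<open>R\<close>-part of a neighbourhood for
  almost all \<open>k\<close>; only the \<open>\<tau>\<close>-part remains to be met.\<close>

lemma upper_limit_topology_R_I:
  assumes v: "\<And>k z. z \<in> A k \<Longrightarrow> R z = v k" "v \<longlonglongrightarrow> R x"
    and x: "x \<in> upper_limit \<tau> A"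
  shows "x \<in> upper_limit (topology_R \<tau> R) A"
  unfolding mem_upper_limit
proof (intro conjI allI impI)
  show "x \<in> topspace (topology_R \<tau> R)" using x by (simp add: mem_upper_limit)
  fix W assume "openin (topology_R \<tau> R) W \<and> x \<in> W"
  then obtain U V where UV: "openin \<tau> U" "x \<in> U" "open V" "R x \<in> V" "U \<inter> R -` V \<subseteq> W"
    using topology_R_neighbourhood by metis
  have "\<exists>\<^sub>F k in sequentially. U \<inter> A k \<noteq> {}"
    using x UV(1,2) by (simp add: mem_upper_limit)
  then have "\<exists>\<^sub>F k in sequentially. U \<inter> A k \<noteq> {} \<and> A k \<subseteq> R -` V"
    by (rule frequently_eventually_frequently) (use v UV(3,4) in \<open>rule eventually_level_near\<close>)
  then show "\<exists>\<^sub>F k in sequentially. W \<inter> A k \<noteq> {}"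
    by (rule frequently_elim1) (use UV(5) in blast)
qed

lemma lower_limit_topology_R_I:
  assumes v: "\<And>k z. z \<in> A k \<Longrightarrow> R z = v k" "v \<longlonglongrightarrow> R x"
    and x: "x \<in> lower_limit \<tau> A"
  shows "x \<in> lower_limit (topology_R \<tau> R) A"
  unfolding mem_lower_limit
proof (intro conjI allI impI)
  show "x \<in> topspace (topology_R \<tau> R)" using x by (simp add: mem_lower_limit)
  fix W assume "openin (topology_R \<tau> R) W \<and> x \<in> W"
  then obtain U V where UV: "openin \<tau> U" "x \<in> U" "open V" "R x \<in> V" "U \<inter> R -` V \<subseteq> W"
    using topology_R_neighbourhood by metis
  have "\<forall>\<^sub>F k in sequentially. A k \<subseteq> R -` V"
    using v UV(3,4) by (rule eventually_level_near)
  moreover have "\<forall>\<^sub>F k in sequentially. U \<inter> A k \<noteq> {}"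
    using x UV(1,2) by (simp add: mem_lower_limit)
  ultimately show "\<forall>\<^sub>F k in sequentially. W \<inter> A k \<noteq> {}"
    by eventually_elim (use UV(5) in blast)
qed

section \<open>Stability of constrained minimisers\<close>

theorem theorem3p9:
  fixes R :: "'x \<Rightarrow> ennreal" and S :: "'y \<Rightarrow> 'y \<Rightarrow> ennreal"
    and \<tau> :: "'x topology"
    and \<beta> :: real and y :: 'y and F :: "'x \<Rightarrow> 'y"
    and \<beta>s :: "nat \<Rightarrow> real" and ys :: "nat \<Rightarrow> 'y" and Fs :: "nat \<Rightarrow> 'x \<Rightarrow> 'y"
  assumes S_zero: "\<And>u z. S u z = 0 \<longleftrightarrow> u = z"
    and top_X: "topspace \<tau> = UNIV"
    and "\<beta> > 0"
    and "\<And>k. \<beta>s k \<ge> 0"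
    and "\<beta>s \<longlonglongrightarrow> \<beta>"
    and "S_uniform_conv S ys y"
    and "locally_S_uniform_conv R S Fs F"
    and compact_Fs: "\<And>w \<gamma> t k. \<gamma> \<ge> 0 \<Longrightarrow> t \<ge> 0 \<Longrightarrow>
          compactin \<tau> (feasible_lev R S (Fs k) w \<gamma> t)"
    and compact_F: "\<And>w \<gamma> t. \<gamma> \<ge> 0 \<Longrightarrow> t \<ge> 0 \<Longrightarrow> compactin \<tau> (feasible_lev R S F w \<gamma> t)"
    \<comment> \<open>closedness is automatic for Hausdorff \<open>\<tau>\<close>; without it the assertion can fail (cofinite topologies)\<close>
    and closed_Fs: "\<And>w \<gamma> t k. \<gamma> \<ge> 0 \<Longrightarrow> t \<ge> 0 \<Longrightarrow>
          closedin \<tau> (feasible_lev R S (Fs k) w \<gamma> t)"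
    and closed_F: "\<And>w \<gamma> t. \<gamma> \<ge> 0 \<Longrightarrow> t \<ge> 0 \<Longrightarrow> closedin \<tau> (feasible_lev R S F w \<gamma> t)"
    and nonempty: "\<And>w \<gamma> k. \<gamma> \<ge> 0 \<Longrightarrow>
          \<exists>t0. feasible_lev R S (Fs k) w \<gamma> t0 \<noteq> {} \<and> feasible_lev R S F w \<gamma> t0 \<noteq> {}"
    and inclusion: "\<And>t. t \<ge> 0 \<Longrightarrow>
          feasible_lev R S F y \<beta> t
            \<subseteq> (\<Inter>\<delta>\<in>{0<..}. \<tau> closure_of (\<Union>\<epsilon>\<in>{0<..}. feasible_lev R S F y (\<beta> - \<epsilon>) (t + \<delta>)))"
  shows "upper_limit (topology_R \<tau> R) (\<lambda>k. solutions R S (Fs k) (ys k) (\<beta>s k)) \<noteq> {} \<and>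
    upper_limit (topology_R \<tau> R) (\<lambda>k. solutions R S (Fs k) (ys k) (\<beta>s k)) \<subseteq> solutions R S F y \<beta> \<and>
    (\<forall>x\<^sub>\<beta>. solutions R S F y \<beta> = {x\<^sub>\<beta>} \<longrightarrow>
      has_set_limit (topology_R \<tau> R) (\<lambda>k. solutions R S (Fs k) (ys k) (\<beta>s k)) {x\<^sub>\<beta>})"
proof -
  define A where "A k = solutions R S (Fs k) (ys k) (\<beta>s k)" for k
  define v where "v k = opt_val R S (Fs k) (ys k) (\<beta>s k)" for k
  define \<Sigma> where "\<Sigma> = solutions R S F y \<beta>"
  have \<beta>0: "\<beta> \<ge> 0" using \<open>\<beta> > 0\<close> by simp
  have close: "\<forall>\<^sub>F k in sequentially. \<forall>x. R x \<le> ennreal t \<longrightarrow>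
      S (Fs k x) (ys k) \<le> S (F x) y + ennreal e \<and> S (F x) y \<le> S (Fs k x) (ys k) + ennreal e"
    if "t \<ge> 0" "e > 0" for t e
    using assms(6,7) that by (rule eventually_discrepancy_close)
  have A_nonempty: "A k \<noteq> {}" for k
  proof -
    obtain t0 where "feasible_lev R S (Fs k) (ys k) (\<beta>s k) t0 \<noteq> {}"
      using nonempty assms(4) by blast
    then show ?thesis
      unfolding A_def
      using opt_val_attained[of "\<beta>s k" \<tau> R S "Fs k" "ys k" t0] compact_Fs closed_Fs assms(4)
      by metis
  qed
  obtain t0 where "feasible_lev R S F y \<beta> t0 \<noteq> {}"
    using nonempty \<beta>0 by blast
  then obtain r where r: "r \<ge> 0" "opt_val R S F y \<beta> = ennreal r"
    using opt_val_attained[of \<beta> \<tau> R S F y t0] compact_F closed_F \<beta>0 by metis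
  have \<Sigma>_eq: "\<Sigma> = feasible_lev R S F y \<beta> r"
    unfolding \<Sigma>_def using solutions_eq_feasible_lev[OF r(2) \<beta>0 r(1)] .
  have R_A: "R z = v k" if "z \<in> A k" for z k
    using that by (simp add: A_def v_def solutions_def)
  have R_\<Sigma>: "R z = ennreal r" if "z \<in> \<Sigma>" for z
    using that r by (simp add: \<Sigma>_def solutions_def)
  have v_le: "\<forall>\<^sub>F k in sequentially. v k \<le> ennreal c" if "c > r" for c
  proof -
    \<comment> \<open>Some feasible point has level below \<open>d > r\<close>, and the remaining
      gap \<open>c - d\<close> serves as the \<open>\<delta>\<close> of
      \<open>inclusion\<close>.\<close>
    define d where "d = (r + c) / 2"
    have d: "r < d" "d < c" "d \<ge> 0" using that r(1) by (auto simp: d_def)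
    have "opt_val R S F y \<beta> < ennreal d" using r d by (simp add: ennreal_less_iff)
    then obtain x where "x \<in> feasible S F y \<beta>" "R x < ennreal d"
      unfolding opt_val_def INF_less_iff by blast
    then have "x \<in> feasible_lev R S F y \<beta> d"
      using \<beta>0 d by (simp add: mem_feasible_lev mem_feasible)
    then have "x \<in> \<tau> closure_of (\<Union>\<epsilon>\<in>{0<..}. feasible_lev R S F y (\<beta> - \<epsilon>) (d + (c - d)))"
      using inclusion[of d] d INT_D[of x _ "{0<..}" "c - d"]
      by (meson greaterThan_iff diff_gt_0_iff_gt subsetD)
    \<comment> \<open>The closure of the empty set is empty, so some \<open>z\<close> exists; its
      closeness to \<open>x\<close> does not matter.\<close>
    then have "(\<Union>\<epsilon>\<in>{0<..}. feasible_lev R S F y (\<beta> - \<epsilon>) c) \<noteq> {}"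
      by (metis add_diff_cancel_left' closure_of_empty diff_add_cancel add.commute empty_iff)
    then obtain \<epsilon> z where z: "\<epsilon> > 0" "z \<in> feasible_lev R S F y (\<beta> - \<epsilon>) c"
      by auto
    have nonneg: "\<beta> - \<epsilon> \<ge> 0" "c \<ge> 0" using feasible_lev_nonneg[OF z(2)] .
    have z': "S (F z) y \<le> ennreal (\<beta> - \<epsilon>)" "R z \<le> ennreal c"
      using z(2) nonneg by (simp_all add: mem_feasible_lev)
    \<comment> \<open>One half of the slack \<open>\<epsilon>\<close> pays for a drop of
      \<open>\<beta>s k\<close> below \<open>\<beta>\<close>, the other for the change of the
      discrepancy.\<close>
    have "\<forall>\<^sub>F k in sequentially. \<beta>s k > \<beta> - \<epsilon> / 2"
      using assms(5) z(1) by (intro order_tendstoD) auto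
    moreover have "\<forall>\<^sub>F k in sequentially. \<forall>x. R x \<le> ennreal c \<longrightarrow>
        S (Fs k x) (ys k) \<le> S (F x) y + ennreal (\<epsilon> / 2) \<and>
        S (F x) y \<le> S (Fs k x) (ys k) + ennreal (\<epsilon> / 2)"
      using nonneg z by (intro close) auto
    ultimately show ?thesis
    proof eventually_elim
      case (elim k)
      have "S (Fs k z) (ys k) \<le> S (F z) y + ennreal (\<epsilon> / 2)"
        using elim(2) z'(2) by blast
      also have "\<dots> \<le> ennreal (\<beta> - \<epsilon>) + ennreal (\<epsilon> / 2)"
        using z'(1) by (rule add_right_mono)
      also have "\<dots> = ennreal (\<beta> - \<epsilon> / 2)"
        using nonneg z(1) by (simp flip: ennreal_plus)
      also have "\<dots> \<le> ennreal (\<beta>s k)"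
        using elim(1) by (intro ennreal_leI) simp
      finally have "z \<in> feasible S (Fs k) (ys k) (\<beta>s k)"
        using assms(4) by (simp add: mem_feasible)
      then have "v k \<le> R z" unfolding v_def by (rule opt_val_le)
      with z'(2) show ?case by (rule order_trans[rotated])
    qed
  qed
  \<comment> \<open>Minimality enters through the bound on \<open>v k\<close>: it keeps
    \<open>A k\<close> in one sublevel set of \<open>R\<close>, where the local estimate
    \<open>close\<close> applies.\<close>
  have A_sub: "\<forall>\<^sub>F k in sequentially. A k \<subseteq> feasible_lev R S F y (\<beta> + e) (r + e)" if "e > 0" for e
  proof -
    have "\<forall>\<^sub>F k in sequentially. v k \<le> ennreal (r + e)"
      using that by (intro v_le) simp
    moreover have "\<forall>\<^sub>F k in sequentially. \<beta>s k < \<beta> + e / 2"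
      using assms(5) that by (intro order_tendstoD) auto
    moreover have "\<forall>\<^sub>F k in sequentially. \<forall>x. R x \<le> ennreal (r + e) \<longrightarrow>
        S (Fs k x) (ys k) \<le> S (F x) y + ennreal (e / 2) \<and>
        S (F x) y \<le> S (Fs k x) (ys k) + ennreal (e / 2)"
      using r that by (intro close) auto
    ultimately show ?thesis
    proof eventually_elim
      case (elim k)
      show ?case
      proof
        fix x assume x: "x \<in> A k"
        have Rx: "R x \<le> ennreal (r + e)" using elim(1) R_A[OF x] by simp
        have "S (Fs k x) (ys k) \<le> ennreal (\<beta>s k)"
          using x assms(4) by (simp add: A_def solutions_def mem_feasible)
        also have "\<dots> \<le> ennreal (\<beta> + e / 2)"
          using elim(2) by (intro ennreal_leI) simp
        finally have "S (Fs k x) (ys k) + ennreal (e / 2) \<le> ennreal (\<beta> + e / 2) + ennreal (e / 2)"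
          by (rule add_right_mono)
        also have "\<dots> = ennreal (\<beta> + e)"
          using \<beta>0 that by (simp flip: ennreal_plus)
        finally have "S (F x) y \<le> ennreal (\<beta> + e)"
          using elim(3) Rx by (meson order_trans)
        then show "x \<in> feasible_lev R S F y (\<beta> + e) (r + e)"
          using Rx \<beta>0 r that by (simp add: mem_feasible_lev)
      qed
    qed
  qed
  define K where "K n = feasible_lev R S F y (\<beta> + 1 / real (Suc n)) (r + 1 / real (Suc n))" for n
  have K: "compactin \<tau> (K n)" "closedin \<tau> (K n)" for n
    unfolding K_def using \<beta>0 r by (simp_all add: compact_F closed_F)
  have K_dec: "decseq K"
    unfolding K_def by (rule decseq_feasible_lev) simp
  have K_Inter: "(\<Inter>n. K n) = \<Sigma>"
    unfolding K_def \<Sigma>_eq by (rule Inter_feasible_lev) simp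
  have A_K: "\<forall>\<^sub>F k in sequentially. A k \<subseteq> K n" for n
    unfolding K_def by (rule A_sub) simp
  \<comment> \<open>The remaining compactness arguments all reduce to this by a choice of test sets
    \<open>D\<close>.\<close>
  have meets: "\<Sigma> \<inter> (\<Inter>n. D n) \<noteq> {}"
    if "\<And>n. closedin \<tau> (D n)" "decseq D" "\<And>n. \<exists>\<^sub>F k in sequentially. A k \<inter> D n \<noteq> {}" for D
    using nested_compact_meets_closed[OF K K_dec A_K that] K_Inter by simp
  have v_lim: "v \<longlonglongrightarrow> ennreal r"
  proof (rule order_tendstoI)
    fix a assume a: "ennreal r < a"
    \<comment> \<open>An intermediate \<open>b\<close> is finite, hence a real bound for
      \<open>v_le\<close>, and makes the final inequality strict.\<close>
    then obtain b where b: "ennreal r < b" "b < a" using dense by blast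
    then obtain c where c: "b = ennreal c" "c \<ge> 0" by (cases b) (auto simp: top_unique)
    with b(1) r have "r < c" by (simp add: ennreal_less_iff)
    from v_le[OF this] show "\<forall>\<^sub>F k in sequentially. v k < a"
      by eventually_elim (use b(2) c in simp)
  next
    fix a assume a: "a < ennreal r"
    then obtain s where s: "a = ennreal s" "s \<ge> 0"
      by (cases a) auto
    show "\<forall>\<^sub>F k in sequentially. a < v k"
    proof (rule ccontr)
      assume "\<not> (\<forall>\<^sub>F k in sequentially. a < v k)"
      then have "\<exists>\<^sub>F k in sequentially. v k \<le> a"
        by (simp add: not_eventually not_less)
      then have "\<exists>\<^sub>F k in sequentially. v k \<le> a \<and> A k \<subseteq> K 0"
        by (rule frequently_eventually_frequently) (rule A_K)
      \<comment> \<open>\<open>K 0\<close> has discrepancy threshold \<open>\<beta> + 1\<close>.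
        Keeping this constraint makes the test set one of the sets assumed closed, unlike a bare
        sublevel set of \<open>R\<close>.\<close>
      then have "\<exists>\<^sub>F k in sequentially. A k \<inter> feasible_lev R S F y (\<beta> + 1) s \<noteq> {}"
      proof (rule frequently_elim1)
        fix k assume k: "v k \<le> a \<and> A k \<subseteq> K 0"
        obtain z where z: "z \<in> A k" using A_nonempty by blast
        with k have "z \<in> K 0" by blast
        then have "z \<in> feasible_lev R S F y (\<beta> + 1) s"
          using k R_A[OF z] s \<beta>0 r by (simp add: K_def mem_feasible_lev)
        with z show "A k \<inter> feasible_lev R S F y (\<beta> + 1) s \<noteq> {}" by blast
      qed
      then have "\<Sigma> \<inter> feasible_lev R S F y (\<beta> + 1) s \<noteq> {}"
        using meets[of "\<lambda>_. feasible_lev R S F y (\<beta> + 1) s"] closed_F s \<beta>0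
        by (simp add: decseq_def)
      then obtain z where "z \<in> \<Sigma>" "R z \<le> a"
        using s \<beta>0 by (auto simp: mem_feasible_lev)
      with R_\<Sigma> a show False by auto
    qed
  qed
  have upper_sub: "upper_limit (topology_R \<tau> R) A \<subseteq> \<Sigma>"
  proof -
    \<comment> \<open>The open complement of \<open>K n\<close> is eventually missed by
      \<open>A k\<close>. Working in \<open>\<tau>\<close> suffices, as the finer topology has the
      smaller upper limit.\<close>
    have "upper_limit \<tau> A \<subseteq> K n" for n
    proof (rule ccontr)
      assume "\<not> upper_limit \<tau> A \<subseteq> K n"
      then obtain x where x: "x \<in> upper_limit \<tau> A" "x \<notin> K n" by blast
      have "openin \<tau> (topspace \<tau> - K n)"
        using K(2) by blast
      moreover have "x \<in> topspace \<tau> - K n"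
        using x(2) top_X by simp
      ultimately have "\<exists>\<^sub>F k in sequentially. (topspace \<tau> - K n) \<inter> A k \<noteq> {}"
        using x(1) unfolding mem_upper_limit by blast
      from frequently_eventually_frequently[OF this A_K[of n]] show False
        by (blast dest: frequently_ex)
    qed
    then show ?thesis
      using K_Inter upper_limit_topology_R_subset[of \<tau> R A] by blast
  qed
  have upper_nonempty: "upper_limit (topology_R \<tau> R) A \<noteq> {}"
  proof -
    \<comment> \<open>With closures of tails as test sets, the intersection of all
      \<open>D n\<close> is the upper limit by definition.\<close>
    define D where "D n = \<tau> closure_of (\<Union>k\<in>{n..}. A k)" for n
    have "\<Sigma> \<inter> (\<Inter>n. D n) \<noteq> {}"
    proof (rule meets)
      show "closedin \<tau> (D n)" for n by (simp add: D_def)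
      show "decseq D"
        unfolding decseq_def D_def by (intro allI impI closure_of_mono UN_mono) auto
      have "A k \<subseteq> D n" if "k \<ge> n" for k n
      proof -
        have "(\<Union>k\<in>{n..}. A k) \<subseteq> D n"
          unfolding D_def by (rule closure_of_subset) (simp add: top_X)
        with that show ?thesis by auto
      qed
      then show "\<exists>\<^sub>F k in sequentially. A k \<inter> D n \<noteq> {}" for n
        using A_nonempty by (intro eventually_frequently eventually_sequentiallyI[of n])
          (auto simp: Int_absorb2)
    qed
    then obtain x where x: "x \<in> \<Sigma>" "x \<in> upper_limit \<tau> A"
      unfolding D_def upper_limit_def by blast
    \<comment> \<open>The point lies in \<open>\<Sigma>\<close>, so its value is the limit of
      \<open>v\<close> and it survives in the finer topology.\<close>
    have "v \<longlonglongrightarrow> R x" using v_lim R_\<Sigma>[OF x(1)] by simp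
    then have "x \<in> upper_limit (topology_R \<tau> R) A"
      using upper_limit_topology_R_I[of A R v x \<tau>] R_A x(2) by blast
    then show ?thesis by blast
  qed
  have "has_set_limit (topology_R \<tau> R) A {x\<^sub>\<beta>}" if single: "\<Sigma> = {x\<^sub>\<beta>}" for x\<^sub>\<beta>
  proof -
    have "x\<^sub>\<beta> \<in> lower_limit \<tau> A"
      unfolding mem_lower_limit
    proof (intro conjI allI impI)
      show "x\<^sub>\<beta> \<in> topspace \<tau>" by (simp add: top_X)
      fix U assume U: "openin \<tau> U \<and> x\<^sub>\<beta> \<in> U"
      show "\<forall>\<^sub>F k in sequentially. U \<inter> A k \<noteq> {}"
      \<comment> \<open>Otherwise the non-empty sets \<open>A k\<close> meet the closed complement
        of \<open>U\<close> infinitely often; then \<open>\<Sigma>\<close> meets it too, although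
        its only point lies in \<open>U\<close>.\<close>
      proof (rule ccontr)
        assume "\<not> (\<forall>\<^sub>F k in sequentially. U \<inter> A k \<noteq> {})"
        then have "\<exists>\<^sub>F k in sequentially. U \<inter> A k = {}"
          by (simp add: not_eventually)
        then have "\<exists>\<^sub>F k in sequentially. A k \<inter> (topspace \<tau> - U) \<noteq> {}"
          by (rule frequently_elim1) (use A_nonempty top_X in blast)
        then have "\<Sigma> \<inter> (topspace \<tau> - U) \<noteq> {}"
          using meets[of "\<lambda>_. topspace \<tau> - U"] U by (simp add: decseq_def closedin_diff)
        with single U show False by blast
      qed
    qed
    moreover have "v \<longlonglongrightarrow> R x\<^sub>\<beta>" using v_lim R_\<Sigma> single by simp
    ultimately have "x\<^sub>\<beta> \<in> lower_limit (topology_R \<tau> R) A"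
      using lower_limit_topology_R_I[of A R v x\<^sub>\<beta> \<tau>] R_A by blast
    \<comment> \<open>The lower limit contains the point and lies in the upper limit, which lies in
      \<open>\<Sigma>\<close>; so all coincide.\<close>
    then show ?thesis
      unfolding has_set_limit_def
      using upper_sub single lower_limit_subset_upper_limit[of "topology_R \<tau> R" A] by blast
  qed
  with upper_sub upper_nonempty show ?thesis
    unfolding A_def \<Sigma>_def by blast
qed

end
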